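(* Let $P\in\mathsf{cpGCL}^{\boxtimes}$ be a program that admits at least one feasible run for every initial state, and let $(\hat P,\hat h)=\mathcal T(P,\mathbf 1)$, where $\mathcal T$ is the observation-hoisting transformation. Then for all $f:\mathbb S\to[0,\infty]$ and $g:\mathbb S\to[0,1]$, $$\mathsf{wp}[\hat P](f)=\underline{\mathsf{cwp}}[P](f)\qquad\text{and}\qquad\mathsf{wlp}[\hat P](g)=\underline{\mathsf{cwlp}}[P](g).$$
   Context: **Programs.** $\mathbb S$ is the set of program states (valuations of program variables). $\mathsf{cpGCL}^{\boxtimes}$ is the set of programs generated by $$P::=\mathtt{skip}\mid\mathtt{abort}\mid x:=E\mid \mathtt{observe}\,G\mid P;P\mid \mathtt{ite}(G)\{P\}\{P\}\mid\{P\}[p]\{P\}\mid\mathtt{while}(G)\{P\},$$ with $x$ a variable, $E$ an arithmetic expression, $G$ a Boolean expression over the variables, and $p:\mathbb S\to[0,1]$ a possibly state-dependent probability (constants being a special case). **Expectations.** $\mathbb E=\{f:\mathbb S\to[0,\infty]\}$, $\mathbb E_{\le1}=\{g:\mathbb S\to[0,1]\}$, ordered pointwise by $\sqsubseteq$. $\mathbf 0,\mathbf 1$ are constant functions; $\chi_G$ is the indicator of $G$; $f[x/E](\sigma)=f(\sigma[x\leftarrow E(\sigma)])$; arithmetic is pointwise with $0\cdot\infty=0$. **wp and wlp.** $\mathsf{wp}[P]:\mathbb E\to\mathbb E$: $\mathsf{wp}[\mathtt{skip}](f)=f$; $\mathsf{wp}[\mathtt{abort}](f)=\mathbf0$; $\mathsf{wp}[x:=E](f)=f[x/E]$;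 $\mathsf{wp}[\mathtt{observe}\,G](f)=\chi_G\cdot f$; $\mathsf{wp}[P_1;P_2]=\mathsf{wp}[P_1]\circ\mathsf{wp}[P_2]$; $\mathsf{wp}[\mathtt{ite}(G)\{P_1\}\{P_2\}](f)=\chi_G\cdot\mathsf{wp}[P_1](f)+\chi_{\neg G}\cdot\mathsf{wp}[P_2](f)$; $\mathsf{wp}[\{P_1\}[p]\{P_2\}](f)=p\cdot\mathsf{wp}[P_1](f)+(\mathbf1-p)\cdot\mathsf{wp}[P_2](f)$; $\mathsf{wp}[\mathtt{while}(G)\{P'\}](f)$ is the least fixed point of $\hat f\mapsto\chi_G\cdot\mathsf{wp}[P'](\hat f)+\chi_{\neg G}\cdot f$ in $(\mathbb E,\sqsubseteq)$. $\mathsf{wlp}[P]:\mathbb E_{\le1}\to\mathbb E_{\le1}$ follows the same rules (with $\mathsf{wlp}$ for $\mathsf{wp}$) except $\mathsf{wlp}[\mathtt{abort}](f)=\mathbf1$ and $\mathsf{wlp}[\mathtt{while}(G)\{P'\}](f)$ is the greatest fixed point of $\hat f\mapsto\chi_G\cdot\mathsf{wlp}[P'](\hat f)+\chi_{\neg G}\cdot f$ in $(\mathbb E_{\le1},\sqsubseteq)$. **cwp and cwlp.** $\mathsf{cwp}[P]:\mathbb E\times\mathbb E_{\le1}\to\mathbb E\times\mathbb E_{\le1}$ (sums and scalar multiples componentwise): $\mathsf{cwp}[\mathtt{skip}](f,g)=(f,g)$; $\mathsf{cwp}[\mathtt{abort}](f,g)=(\mathbf0,\mathbf1)$; $\mathsf{cwp}[x:=E](f,g)=(f[x/E],g[x/E])$;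 $\mathsf{cwp}[\mathtt{observe}\,G](f,g)=\chi_G\cdot(f,g)$; $\mathsf{cwp}[P_1;P_2]=\mathsf{cwp}[P_1]\circ\mathsf{cwp}[P_2]$; $\mathsf{cwp}[\mathtt{ite}(G)\{P_1\}\{P_2\}](f,g)=\chi_G\cdot\mathsf{cwp}[P_1](f,g)+\chi_{\neg G}\cdot\mathsf{cwp}[P_2](f,g)$; $\mathsf{cwp}[\{P_1\}[p]\{P_2\}](f,g)=p\cdot\mathsf{cwp}[P_1](f,g)+(\mathbf1-p)\cdot\mathsf{cwp}[P_2](f,g)$; $\mathsf{cwp}[\mathtt{while}(G)\{P'\}](f,g)$ is the least fixed point w.r.t. $(\sqsubseteq,\sqsupseteq)$ of $(\hat f,\hat g)\mapsto\chi_G\cdot\mathsf{cwp}[P'](\hat f,\hat g)+\chi_{\neg G}\cdot(f,g)$. $\mathsf{cwlp}[P]$ on $\mathbb E_{\le1}\times\mathbb E_{\le1}$ follows the same rules (with $\mathsf{cwlp}$ for $\mathsf{cwp}$) except $\mathsf{cwlp}[\mathtt{abort}](f,g)=(\mathbf1,\mathbf1)$ and the loop is the greatest fixed point w.r.t. $(\sqsubseteq,\sqsubseteq)$ of $(\hat f,\hat g)\mapsto\chi_G\cdot\mathsf{cwlp}[P'](\hat f,\hat g)+\chi_{\neg G}\cdot(f,g)$. With $\mathsf{cwp}_i,\mathsf{cwlp}_i$ the $i$-th components, $\underline{\mathsf{cwp}}[P](f)=\mathsf{cwp}_1[P](f,\mathbf1)/\mathsf{cwp}_2[P](f,\mathbf1)$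 and $\underline{\mathsf{cwlp}}[P](f)=\mathsf{cwlp}_1[P](f,\mathbf1)/\mathsf{cwlp}_2[P](f,\mathbf1)$. "$P$ admits at least one feasible run for every initial state" means that the denominator $\mathsf{cwp}_2[P](f,\mathbf1)(\sigma)$ (which does not depend on $f$ and is the same for $\mathsf{cwlp}$) is $>0$ for every $\sigma\in\mathbb S$, i.e. the quotients are defined everywhere. **Transformation.** $\mathcal T:\mathsf{cpGCL}^{\boxtimes}\times\mathbb E_{\le1}\to\mathsf{cpGCL}^{\boxtimes}\times\mathbb E_{\le1}$ is defined inductively: - $\mathcal T(\mathtt{skip},f)=(\mathtt{skip},f)$; $\mathcal T(\mathtt{abort},f)=(\mathtt{abort},\mathbf1)$; $\mathcal T(x:=E,f)=(x:=E,f[x/E])$; $\mathcal T(\mathtt{observe}\,G,f)=(\mathtt{skip},\chi_G\cdot f)$. - $\mathcal T(\mathtt{ite}(G)\{P\}\{Q\},f)=(\mathtt{ite}(G)\{P'\}\{Q'\},\ \chi_G\cdot f_P+\chi_{\neg G}\cdot f_Q)$ where $(P',f_P)=\mathcal T(P,f)$, $(Q',f_Q)=\mathcal T(Q,f)$. - $\mathcal T(\{P\}[p]\{Q\},f)=(\{P'\}[p']\{Q'\},\ p\cdot f_P+(\mathbf1-p)\cdot f_Q)$ where $(P',f_P)=\mathcal T(P,f)$, $(Q',f_Q)=\mathcal T(Q,f)$ and $p'=\dfrac{p\cdot f_P}{p\cdot f_P+(\mathbf1-p)\cdot f_Q}$ (with an arbitrary value in $[0,1]$ at states where the denominator is $0$).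 - $\mathcal T(\mathtt{while}(G)\{P\},f)=(\mathtt{while}(G)\{P'\},f')$ where $f'$ is the greatest fixed point in $(\mathbb E_{\le1},\sqsubseteq)$ of $X\mapsto\chi_G\cdot\pi_2(\mathcal T(P,X))+\chi_{\neg G}\cdot f$ ($\pi_2$ is the second projection), and $P'$ is the first component of $\mathcal T(P,f')$. - $\mathcal T(P;Q,f)=(P';Q',f'')$ where $(Q',f')=\mathcal T(Q,f)$ and $(P',f'')=\mathcal T(P,f')$. *)

theory Defs
  imports
    "HOL-Library.Extended_Nonnegative_Real"
    "HOL-Library.Product_Order"
    "HOL-Library.Dual_Ordered_Lattice"
begin

section \<open>The unit interval as a complete lattice\<close>

typedef prob = "{x :: ennreal. x \<le> 1}"
  morphisms ennreal_of_prob prob_of_ennreal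
  by (rule exI[of _ 0]) simp

setup_lifting type_definition_prob

instantiation prob :: "{zero_neq_one, times, complete_lattice, linorder}"
begin

lift_definition zero_prob :: prob is 0 by simp
lift_definition one_prob :: prob is 1 by simp
lift_definition times_prob :: "prob \<Rightarrow> prob \<Rightarrow> prob" is "(*)"
  using mult_mono by fastforce
lift_definition less_eq_prob :: "prob \<Rightarrow> prob \<Rightarrow> bool" is "(\<le>)" .
lift_definition less_prob :: "prob \<Rightarrow> prob \<Rightarrow> bool" is "(<)" .
lift_definition inf_prob :: "prob \<Rightarrow> prob \<Rightarrow> prob" is inf by (simp add: le_infI1)
lift_definition sup_prob :: "prob \<Rightarrow> prob \<Rightarrow> prob" is sup by simp
lift_definition bot_prob :: prob is 0 by simp
lift_definition top_prob :: prob is 1 by simp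
lift_definition Inf_prob :: "prob set \<Rightarrow> prob" is "\<lambda>A. inf 1 (Inf A)" by simp
lift_definition Sup_prob :: "prob set \<Rightarrow> prob" is Sup by (simp add: Sup_le_iff)

instance
proof
  fix x y z :: prob and A :: "prob set"
  show "(0::prob) \<noteq> 1" by transfer simp
  show "(x < y) = (x \<le> y \<and> \<not> y \<le> x)" by transfer (rule less_le_not_le)
  show "x \<le> x" by transfer (rule order_refl)
  show "x \<le> y \<Longrightarrow> y \<le> z \<Longrightarrow> x \<le> z" by transfer (rule order_trans)
  show "x \<le> y \<Longrightarrow> y \<le> x \<Longrightarrow> x = y" by transfer (rule antisym)
  show "x \<le> y \<or> y \<le> x" by transfer (rule linear)
  show "inf x y \<le> x" by transfer (rule inf_le1)
  show "inf x y \<le> y" by transfer (rule inf_le2)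
  show "x \<le> y \<Longrightarrow> x \<le> z \<Longrightarrow> x \<le> inf y z" by transfer (rule inf_greatest)
  show "x \<le> sup x y" by transfer (rule sup_ge1)
  show "y \<le> sup x y" by transfer (rule sup_ge2)
  show "y \<le> x \<Longrightarrow> z \<le> x \<Longrightarrow> sup y z \<le> x" by transfer (rule sup_least)
  show "x \<in> A \<Longrightarrow> Inf A \<le> x" by transfer (rule le_infI2, rule Inf_lower)
  show "(\<And>x. x \<in> A \<Longrightarrow> z \<le> x) \<Longrightarrow> z \<le> Inf A"
    by transfer (rule inf_greatest, assumption, rule Inf_greatest, blast)
  show "x \<in> A \<Longrightarrow> x \<le> Sup A" by transfer (rule Sup_upper)
  show "(\<And>x. x \<in> A \<Longrightarrow> x \<le> z) \<Longrightarrow> Sup A \<le> z" by transfer (rule Sup_least, blast)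
  show "Inf {} = (top :: prob)" by transfer simp
  show "Sup {} = (bot :: prob)" by transfer (simp add: bot_ennreal)
qed

end

lemma convex_le_one:
  fixes p a b :: ennreal
  assumes "p \<le> 1" "a \<le> 1" "b \<le> 1"
  shows "p * a + (1 - p) * b \<le> 1"
proof -
  have "p * a + (1 - p) * b \<le> p * 1 + (1 - p) * 1"
    using assms by (intro add_mono mult_left_mono) auto
  also have "\<dots> = 1"
    using assms by (simp add: add_diff_inverse_ennreal)
  finally show ?thesis .
qed

lemma ennreal_fraction_le_one: "a / (a + b) \<le> 1" for a b :: ennreal
proof (cases "a + b = 0 \<or> a + b = top")
  case True
  then show ?thesis by (auto simp: divide_ennreal_def)
next
  case False
  have "a / (a + b) \<le> (a + b) / (a + b)"
    by (rule divide_right_mono_ennreal) simp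
  also have "\<dots> = 1"
    using False by (intro ennreal_divide_self) (auto simp: less_top)
  finally show ?thesis .
qed

text \<open>\<open>p \<cdot> a + (1 - p) \<cdot> b\<close>, computed in \<open>[0,1]\<close> and in \<open>[0,\<infinity>]\<close>. With \<open>p = of_bool c\<close> this is
  \<open>\<chi>\<^sub>c \<cdot> a + \<chi>\<^sub>\<not>\<^sub>c \<cdot> b\<close>.\<close>

lift_definition mix :: "prob \<Rightarrow> prob \<Rightarrow> prob \<Rightarrow> prob"
  is "\<lambda>p a b. p * a + (1 - p) * b"
  by (rule convex_le_one)

definition mix_ennreal :: "prob \<Rightarrow> ennreal \<Rightarrow> ennreal \<Rightarrow> ennreal" where
  "mix_ennreal p a b = ennreal_of_prob p * a + (1 - ennreal_of_prob p) * b"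

text \<open>\<open>p \<cdot> a / (p \<cdot> a + (1 - p) \<cdot> b)\<close>; only used where the denominator \<open>mix p a b\<close> is nonzero.\<close>

lift_definition mix_ratio :: "prob \<Rightarrow> prob \<Rightarrow> prob \<Rightarrow> prob"
  is "\<lambda>p a b. p * a / (p * a + (1 - p) * b)"
  by (rule ennreal_fraction_le_one)


section \<open>Programs and expectations\<close>

type_synonym ('v, 'a) state = "'v \<Rightarrow> 'a"
type_synonym 's expectation = "'s \<Rightarrow> ennreal"
type_synonym 's expectation1 = "'s \<Rightarrow> prob"

text \<open>Expressions and guards are represented by their semantics.\<close>

datatype ('v, 'a) prog =
    Skip
  | Abort
  | Assign 'v "('v, 'a) state \<Rightarrow> 'a"
  | Observe "('v, 'a) state \<Rightarrow> bool"
  | Seq "('v, 'a) prog" "('v, 'a) prog"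
  | Ite "('v, 'a) state \<Rightarrow> bool" "('v, 'a) prog" "('v, 'a) prog"
  | Choice "('v, 'a) prog" "('v, 'a) state \<Rightarrow> prob" "('v, 'a) prog"
  | While "('v, 'a) state \<Rightarrow> bool" "('v, 'a) prog"

definition chi :: "('s \<Rightarrow> bool) \<Rightarrow> 's expectation1" where
  "chi G = (\<lambda>\<sigma>. of_bool (G \<sigma>))"

definition subst :: "(('v, 'a) state \<Rightarrow> 'b) \<Rightarrow> 'v \<Rightarrow> (('v, 'a) state \<Rightarrow> 'a) \<Rightarrow> ('v, 'a) state \<Rightarrow> 'b" where
  "subst f x E = (\<lambda>\<sigma>. f (\<sigma>(x := E \<sigma>)))"

definition scaleE :: "'s expectation1 \<Rightarrow> 's expectation \<Rightarrow> 's expectation" where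
  "scaleE p f = (\<lambda>\<sigma>. ennreal_of_prob (p \<sigma>) * f \<sigma>)"

definition scaleE1 :: "'s expectation1 \<Rightarrow> 's expectation1 \<Rightarrow> 's expectation1" where
  "scaleE1 p g = (\<lambda>\<sigma>. p \<sigma> * g \<sigma>)"

definition mixE :: "'s expectation1 \<Rightarrow> 's expectation \<Rightarrow> 's expectation \<Rightarrow> 's expectation" where
  "mixE p f f' = (\<lambda>\<sigma>. mix_ennreal (p \<sigma>) (f \<sigma>) (f' \<sigma>))"

definition mixE1 :: "'s expectation1 \<Rightarrow> 's expectation1 \<Rightarrow> 's expectation1 \<Rightarrow> 's expectation1" where
  "mixE1 p g g' = (\<lambda>\<sigma>. mix (p \<sigma>) (g \<sigma>) (g' \<sigma>))"


section \<open>Weakest preexpectation semantics\<close>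

primrec wp :: "('v, 'a) prog \<Rightarrow> ('v, 'a) state expectation \<Rightarrow> ('v, 'a) state expectation" where
  "wp Skip f = f"
| "wp Abort f = (\<lambda>_. 0)"
| "wp (Assign x E) f = subst f x E"
| "wp (Observe G) f = scaleE (chi G) f"
| "wp (Seq P Q) f = wp P (wp Q f)"
| "wp (Ite G P Q) f = mixE (chi G) (wp P f) (wp Q f)"
| "wp (Choice P p Q) f = mixE p (wp P f) (wp Q f)"
| "wp (While G P) f = lfp (\<lambda>X. mixE (chi G) (wp P X) f)"

primrec wlp :: "('v, 'a) prog \<Rightarrow> ('v, 'a) state expectation1 \<Rightarrow> ('v, 'a) state expectation1" where
  "wlp Skip g = g"
| "wlp Abort g = (\<lambda>_. 1)"
| "wlp (Assign x E) g = subst g x E"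
| "wlp (Observe G) g = scaleE1 (chi G) g"
| "wlp (Seq P Q) g = wlp P (wlp Q g)"
| "wlp (Ite G P Q) g = mixE1 (chi G) (wlp P g) (wlp Q g)"
| "wlp (Choice P p Q) g = mixE1 p (wlp P g) (wlp Q g)"
| "wlp (While G P) g = gfp (\<lambda>X. mixE1 (chi G) (wlp P X) g)"


section \<open>Conditional weakest preexpectation semantics\<close>

definition mixEE1 :: "'s expectation1 \<Rightarrow> 's expectation \<times> 's expectation1 \<Rightarrow>
    's expectation \<times> 's expectation1 \<Rightarrow> 's expectation \<times> 's expectation1" where
  "mixEE1 p z z' = (mixE p (fst z) (fst z'), mixE1 p (snd z) (snd z'))"

definition mixE1E1 :: "'s expectation1 \<Rightarrow> 's expectation1 \<times> 's expectation1 \<Rightarrow>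
    's expectation1 \<times> 's expectation1 \<Rightarrow> 's expectation1 \<times> 's expectation1" where
  "mixE1E1 p z z' = (mixE1 p (fst z) (fst z'), mixE1 p (snd z) (snd z'))"

text \<open>Least fixed point with respect to the order \<open>(\<sqsubseteq>, \<sqsupseteq>)\<close>: the type \<open>dual\<close> reverses the order on
  the second component.\<close>

definition lfp_dual :: "('a::complete_lattice \<times> 'b::complete_lattice \<Rightarrow> 'a \<times> 'b) \<Rightarrow> 'a \<times> 'b" where
  "lfp_dual F = map_prod id undual (lfp (map_prod id dual \<circ> F \<circ> map_prod id undual))"

primrec cwp :: "('v, 'a) prog \<Rightarrow> ('v, 'a) state expectation \<times> ('v, 'a) state expectation1 \<Rightarrow>
    ('v, 'a) state expectation \<times> ('v, 'a) state expectation1" where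
  "cwp Skip z = z"
| "cwp Abort z = ((\<lambda>_. 0), (\<lambda>_. 1))"
| "cwp (Assign x E) z = (subst (fst z) x E, subst (snd z) x E)"
| "cwp (Observe G) z = (scaleE (chi G) (fst z), scaleE1 (chi G) (snd z))"
| "cwp (Seq P Q) z = cwp P (cwp Q z)"
| "cwp (Ite G P Q) z = mixEE1 (chi G) (cwp P z) (cwp Q z)"
| "cwp (Choice P p Q) z = mixEE1 p (cwp P z) (cwp Q z)"
| "cwp (While G P) z = lfp_dual (\<lambda>Z. mixEE1 (chi G) (cwp P Z) z)"

primrec cwlp :: "('v, 'a) prog \<Rightarrow> ('v, 'a) state expectation1 \<times> ('v, 'a) state expectation1 \<Rightarrow>
    ('v, 'a) state expectation1 \<times> ('v, 'a) state expectation1" where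
  "cwlp Skip z = z"
| "cwlp Abort z = ((\<lambda>_. 1), (\<lambda>_. 1))"
| "cwlp (Assign x E) z = (subst (fst z) x E, subst (snd z) x E)"
| "cwlp (Observe G) z = (scaleE1 (chi G) (fst z), scaleE1 (chi G) (snd z))"
| "cwlp (Seq P Q) z = cwlp P (cwlp Q z)"
| "cwlp (Ite G P Q) z = mixE1E1 (chi G) (cwlp P z) (cwlp Q z)"
| "cwlp (Choice P p Q) z = mixE1E1 p (cwlp P z) (cwlp Q z)"
| "cwlp (While G P) z = gfp (\<lambda>Z. mixE1E1 (chi G) (cwlp P Z) z)"

definition cwp_quot :: "('v, 'a) prog \<Rightarrow> ('v, 'a) state expectation \<Rightarrow> ('v, 'a) state expectation" where
  "cwp_quot P f = (\<lambda>\<sigma>. fst (cwp P (f, \<lambda>_. 1)) \<sigma> / ennreal_of_prob (snd (cwp P (f, \<lambda>_. 1)) \<sigma>))"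

definition cwlp_quot :: "('v, 'a) prog \<Rightarrow> ('v, 'a) state expectation1 \<Rightarrow> ('v, 'a) state expectation" where
  "cwlp_quot P g = (\<lambda>\<sigma>. ennreal_of_prob (fst (cwlp P (g, \<lambda>_. 1)) \<sigma>) /
     ennreal_of_prob (snd (cwlp P (g, \<lambda>_. 1)) \<sigma>))"

definition feasible :: "('v, 'a) prog \<Rightarrow> bool" where
  "feasible P \<longleftrightarrow> (\<forall>f \<sigma>. 0 < snd (cwp P (f, \<lambda>_. 1)) \<sigma>)"


section \<open>Observation hoisting\<close>

text \<open>The parameter \<open>arb\<close> supplies the arbitrary probabilities used at states where the denominator of
  \<open>p'\<close> vanishes. Its arguments are the probabilistic choice being transformed, the postexpectation and
  the state, so every function obeying the defining rules of the transformation is an instance.\<close>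

primrec hoist :: "(('v, 'a) prog \<Rightarrow> ('v, 'a) state expectation1 \<Rightarrow> ('v, 'a) state \<Rightarrow> prob) \<Rightarrow>
    ('v, 'a) prog \<Rightarrow> ('v, 'a) state expectation1 \<Rightarrow> ('v, 'a) prog \<times> ('v, 'a) state expectation1" where
  "hoist arb Skip f = (Skip, f)"
| "hoist arb Abort f = (Abort, (\<lambda>_. 1))"
| "hoist arb (Assign x E) f = (Assign x E, subst f x E)"
| "hoist arb (Observe G) f = (Skip, scaleE1 (chi G) f)"
| "hoist arb (Seq P Q) f =
    (let (Q', f') = hoist arb Q f; (P', f'') = hoist arb P f' in (Seq P' Q', f''))"
| "hoist arb (Ite G P Q) f =
    (let (P', fP) = hoist arb P f; (Q', fQ) = hoist arb Q f
     in (Ite G P' Q', mixE1 (chi G) fP fQ))"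
| "hoist arb (Choice P p Q) f =
    (let (P', fP) = hoist arb P f; (Q', fQ) = hoist arb Q f;
         p' = (\<lambda>\<sigma>. if mix (p \<sigma>) (fP \<sigma>) (fQ \<sigma>) = 0 then arb (Choice P p Q) f \<sigma>
                   else mix_ratio (p \<sigma>) (fP \<sigma>) (fQ \<sigma>))
     in (Choice P' p' Q', mixE1 p fP fQ))"
| "hoist arb (While G P) f =
    (let f' = gfp (\<lambda>X. mixE1 (chi G) (snd (hoist arb P X)) f)
     in (While G (fst (hoist arb P f')), f'))"

end

(*  Write h = wlp P f0 for the second component of hoist P f0, and P' for the first. Every program
    satisfies h * wp P' f = wp P (f0 * f) and h * wlp P' g = wlp P (f0 * g), by induction on P. For
    loops this is fixed-point fusion along multiplication by h, which preserves all suprema (hence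
    least fixed points) and all nonempty infima; the top element, where the transfinite iteration
    of the greatest fixed point starts, is sent to h = wlp P f0, which dominates wlp P (f0 * g).
    As cwp and cwlp are pairs of wp and wlp, the claim is the case f0 = 1 divided by h > 0. *)

theory Submission
  imports Defs
begin

section \<open>Fixed points\<close>

text \<open>The elements that \<open>\<alpha>\<close> maps below \<open>lfp H\<close> are closed
  under \<open>F\<close> and under suprema, so \<open>lfp F\<close> is one of them. Conversely,
  \<open>\<alpha> (lfp F)\<close> is a fixed point of \<open>H\<close>.\<close>

lemma lfp_fusion:
  fixes F :: "'a::complete_lattice \<Rightarrow> 'a" and H :: "'b::complete_lattice \<Rightarrow> 'b"
  assumes "mono F" "mono H"
    and Sup: "\<And>M. \<alpha> (Sup M) = Sup (\<alpha> ` M)"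
    and commute: "\<And>x. \<alpha> (F x) = H (\<alpha> x)"
  shows "\<alpha> (lfp F) = lfp H"
proof (rule antisym)
  show "\<alpha> (lfp F) \<le> lfp H"
  proof (rule lfp_ordinal_induct[OF \<open>mono F\<close>])
    fix x assume "\<alpha> x \<le> lfp H"
    then have "H (\<alpha> x) \<le> H (lfp H)" by (rule monoD[OF \<open>mono H\<close>])
    then show "\<alpha> (F x) \<le> lfp H"
      using lfp_unfold[OF \<open>mono H\<close>] by (simp add: commute)
  next
    fix M assume "\<forall>x\<in>M. \<alpha> x \<le> lfp H"
    then show "\<alpha> (Sup M) \<le> lfp H" by (auto simp: Sup intro: SUP_least)
  qed
  show "lfp H \<le> \<alpha> (lfp F)"
    using commute[of "lfp F"] lfp_unfold[OF \<open>mono F\<close>] by (intro lfp_lowerbound) simp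
qed

text \<open>Dual to \<open>lfp_fusion\<close>, but for maps such as scaling that may move
  \<open>top\<close>: the empty infimum gets its own assumption, and \<open>Inf\<close> asks only
  for the inequality used in the ordinal induction.\<close>

lemma gfp_fusion:
  fixes F :: "'a::complete_lattice \<Rightarrow> 'a" and H :: "'b::complete_lattice \<Rightarrow> 'b"
  assumes "mono F" "mono H"
    and Inf: "\<And>M y. M \<noteq> {} \<Longrightarrow> (\<And>x. x \<in> M \<Longrightarrow> y \<le> \<alpha> x) \<Longrightarrow> y \<le> \<alpha> (Inf M)"
    and top: "gfp H \<le> \<alpha> top"
    and commute: "\<And>x. \<alpha> (F x) = H (\<alpha> x)"
  shows "\<alpha> (gfp F) = gfp H"
proof (rule antisym)
  show "gfp H \<le> \<alpha> (gfp F)"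
  proof (rule gfp_ordinal_induct[OF \<open>mono F\<close>])
    fix x assume "gfp H \<le> \<alpha> x"
    then have "H (gfp H) \<le> H (\<alpha> x)" by (rule monoD[OF \<open>mono H\<close>])
    then show "gfp H \<le> \<alpha> (F x)"
      using gfp_unfold[OF \<open>mono H\<close>] by (simp add: commute)
  next
    fix M assume "\<forall>x\<in>M. gfp H \<le> \<alpha> x"
    then show "gfp H \<le> \<alpha> (Inf M)"
      using Inf[of M] top by (cases "M = {}") auto
  qed
  show "\<alpha> (gfp F) \<le> gfp H"
    using commute[of "gfp F"] gfp_unfold[OF \<open>mono F\<close>] by (intro gfp_upperbound) simp
qed

section \<open>Fixed points of product maps and the reversed order\<close>

lemma lfp_prod:
  fixes A :: "'a::complete_lattice \<Rightarrow> 'a" and B :: "'b::complete_lattice \<Rightarrow> 'b"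
  assumes "mono A" "mono B"
  shows "lfp (map_prod A B) = (lfp A, lfp B)"
proof (rule antisym)
  show "lfp (map_prod A B) \<le> (lfp A, lfp B)"
    using lfp_unfold[OF \<open>mono A\<close>] lfp_unfold[OF \<open>mono B\<close>]
    by (intro lfp_lowerbound) simp
  show "(lfp A, lfp B) \<le> lfp (map_prod A B)"
    by (rule lfp_greatest) (auto simp: less_eq_prod_def intro: lfp_lowerbound)
qed

lemma gfp_prod:
  fixes A :: "'a::complete_lattice \<Rightarrow> 'a" and B :: "'b::complete_lattice \<Rightarrow> 'b"
  assumes "mono A" "mono B"
  shows "gfp (map_prod A B) = (gfp A, gfp B)"
proof (rule antisym)
  show "(gfp A, gfp B) \<le> gfp (map_prod A B)"
    using gfp_unfold[OF \<open>mono A\<close>] gfp_unfold[OF \<open>mono B\<close>]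
    by (intro gfp_upperbound) simp
  show "gfp (map_prod A B) \<le> (gfp A, gfp B)"
    by (rule gfp_least) (auto simp: less_eq_prod_def intro: gfp_upperbound)
qed

text \<open>Since \<open>dual\<close> reverses the order, pre-fixed points of the conjugated map
  correspond to post-fixed points of \<open>B\<close>.\<close>

lemma lfp_dual_eq_gfp:
  fixes B :: "'b::complete_lattice \<Rightarrow> 'b"
  assumes "mono B"
  shows "lfp (dual \<circ> B \<circ> undual) = dual (gfp B)"
proof (rule antisym)
  show "lfp (dual \<circ> B \<circ> undual) \<le> dual (gfp B)"
    using gfp_unfold[OF assms] by (intro lfp_lowerbound) simp
  show "dual (gfp B) \<le> lfp (dual \<circ> B \<circ> undual)"
  proof (rule lfp_greatest)
    fix u assume "(dual \<circ> B \<circ> undual) u \<le> u"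
    then have "undual u \<le> B (undual u)"
      by (simp add: less_eq_dual.rep_eq)
    then have "undual u \<le> gfp B" by (rule gfp_upperbound)
    then show "dual (gfp B) \<le> u" by (simp add: less_eq_dual.rep_eq)
  qed
qed

text \<open>Splits a \<open>cwp\<close> loop into a \<open>wp\<close> loop and a \<open>wlp\<close>
  loop: conjugation affects the second component only, so the map stays a product.\<close>

lemma lfp_dual_prod:
  fixes A :: "'a::complete_lattice \<Rightarrow> 'a" and B :: "'b::complete_lattice \<Rightarrow> 'b"
  assumes "mono A" "mono B"
  shows "lfp_dual (map_prod A B) = (lfp A, gfp B)"
proof -
  have eq: "map_prod id dual \<circ> map_prod A B \<circ> map_prod id undual
      = map_prod A (dual \<circ> B \<circ> undual)"
    by (auto simp: fun_eq_iff)
  have "mono (dual \<circ> B \<circ> undual)"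
    using assms(2) by (auto simp: mono_def less_eq_dual.rep_eq)
  then show ?thesis
    unfolding lfp_dual_def eq using assms
    by (simp add: lfp_prod lfp_dual_eq_gfp)
qed


section \<open>Arithmetic in the unit interval\<close>

lemma prob_le_one: "ennreal_of_prob x \<le> 1"
  by transfer

lemma mix_mono:
  "a \<le> a' \<Longrightarrow> b \<le> b' \<Longrightarrow> mix p a b \<le> mix p a' b'"
  by transfer (intro add_mono mult_left_mono, auto)

lemma mix_ennreal_mono:
  "a \<le> a' \<Longrightarrow> b \<le> b' \<Longrightarrow> mix_ennreal p a b \<le> mix_ennreal p a' b'"
  unfolding mix_ennreal_def by (intro add_mono mult_left_mono) auto

lemma mult_le_left_prob: "a * b \<le> a" for a b :: prob
  by transfer (metis mult.right_neutral mult_left_mono zero_le)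

lemma mult_left_mono_prob: "a \<le> b \<Longrightarrow> c * a \<le> c * b" for a b c :: prob
  by transfer (simp add: mult_left_mono)

lemma mult_one_prob [simp]: "a * 1 = a" "1 * a = a" for a :: prob
  by (transfer, simp)+

lemma mult_zero_prob [simp]: "a * 0 = 0" "0 * a = 0" for a :: prob
  by (transfer, simp)+

lemma mult_assoc_prob: "a * b * c = a * (b * c)" for a b c :: prob
  by transfer (simp add: mult.assoc)

lemma mix_of_bool [simp]: "mix (of_bool c) a b = (if c then a else b)"
  by (cases c; simp; transfer; simp)

text \<open>The discarded branch may be infinite; it vanishes because 0 times \<open>top\<close> is
  0.\<close>

lemma mix_ennreal_of_bool [simp]: "mix_ennreal (of_bool c) a b = (if c then a else b)"
  by (cases c) (simp_all add: mix_ennreal_def zero_prob.rep_eq one_prob.rep_eq)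

text \<open>For nonzero \<open>c\<close>, divide by \<open>c\<close> and take the infimum. For
  \<open>c = 0\<close>, a member of \<open>M\<close> forces \<open>y = 0\<close>; the empty set,
  whose infimum is 1, would give no such bound.\<close>

lemma le_mult_Inf_prob:
  fixes c y :: prob
  assumes "M \<noteq> {}" and le: "\<And>x. x \<in> M \<Longrightarrow> y \<le> c * x"
  shows "y \<le> c * Inf M"
proof (cases "c = 0")
  case True
  then show ?thesis using assms by (metis ex_in_conv mult_zero_prob(2))
next
  case False
  let ?c = "ennreal_of_prob c" and ?y = "ennreal_of_prob y"
  have c: "?c \<noteq> 0" "?c \<noteq> top"
    using False prob_le_one[of c]
    by (auto simp: zero_prob.rep_eq ennreal_of_prob_inject[symmetric] top_unique)
  have "?y / ?c \<le> ennreal_of_prob x" if "x \<in> M" for x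
  proof -
    have "?y \<le> ?c * ennreal_of_prob x"
      using le[OF that] by (simp add: less_eq_prob.rep_eq times_prob.rep_eq)
    then show ?thesis
      using c by (intro divide_le_posI_ennreal) (auto simp: mult.commute zero_less_iff_neq_zero)
  qed
  \<comment> \<open>\<open>Inf\<close> on \<open>prob\<close> is capped at 1, so the quotient,
    computed in \<open>ennreal\<close>, must be bounded by 1 as well; any member of \<open>M\<close>
    shows this.\<close>
  moreover from this have "?y / ?c \<le> 1"
    using \<open>M \<noteq> {}\<close> prob_le_one by (meson ex_in_conv order_trans)
  ultimately have "?y / ?c \<le> ennreal_of_prob (Inf M)"
    by (auto simp: Inf_prob.rep_eq intro: INF_greatest)
  then have "?c * (?y / ?c) \<le> ?c * ennreal_of_prob (Inf M)"
    by (rule mult_left_mono) simp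
  moreover have "?c * (?y / ?c) = ?y"
    using c by (metis ennreal_times_divide mult.commute mult_divide_eq_ennreal)
  ultimately show ?thesis
    by (simp add: less_eq_prob.rep_eq times_prob.rep_eq)
qed

text \<open>The hypothesis on \<open>q\<close> leaves its value free where the mixture vanishes: both sides are then 0.\<close>

lemma mix_ratio_weights:
  assumes "mix p a b \<noteq> 0 \<Longrightarrow> q = mix_ratio p a b"
  shows "ennreal_of_prob (mix p a b) * ennreal_of_prob q = ennreal_of_prob p * ennreal_of_prob a"
    and "ennreal_of_prob (mix p a b) * (1 - ennreal_of_prob q)
      = (1 - ennreal_of_prob p) * ennreal_of_prob b"
proof -
  define s t where "s = ennreal_of_prob p * ennreal_of_prob a"
    and "t = (1 - ennreal_of_prob p) * ennreal_of_prob b"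
  have m: "ennreal_of_prob (mix p a b) = s + t"
    by (simp add: s_def t_def mix.rep_eq)
  \<comment> \<open>Finiteness permits both cancelling \<open>s + t\<close> and distributing over
    the truncated subtraction of \<open>ennreal\<close>.\<close>
  have fin: "s + t \<noteq> top"
    using prob_le_one[of "mix p a b"] by (auto simp: m top_unique)
  have "(s + t) * ennreal_of_prob q = s \<and> (s + t) * (1 - ennreal_of_prob q) = t"
  proof (cases "s + t = 0")
    case True
    then show ?thesis by simp
  next
    case False
    then have "mix p a b \<noteq> 0" by (auto simp: m[symmetric] zero_prob.rep_eq)
    then have q: "ennreal_of_prob q = s / (s + t)"
      using assms by (simp add: mix_ratio.rep_eq s_def t_def)
    have s: "(s + t) * (s / (s + t)) = s"
      using False fin by (simp add: ennreal_times_divide mult_divide_eq_ennreal mult.commute)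
    then have "(s + t) * (1 - s / (s + t)) = s + t - s"
      using fin by (simp add: ennreal_right_diff_distrib)
    then show ?thesis
      using s q fin by simp
  qed
  then show "ennreal_of_prob (mix p a b) * ennreal_of_prob q = ennreal_of_prob p * ennreal_of_prob a"
    and "ennreal_of_prob (mix p a b) * (1 - ennreal_of_prob q)
      = (1 - ennreal_of_prob p) * ennreal_of_prob b"
    by (simp_all add: m s_def t_def)
qed

text \<open>Multiplying by the normalising constant turns the weights \<open>q\<close> and
  \<open>1 - q\<close> back into the unnormalised \<open>p * a\<close> and
  \<open>(1 - p) * b\<close>. This settles the probabilistic choice.\<close>

lemma mult_mix_ennreal_ratio:
  assumes "mix p a b \<noteq> 0 \<Longrightarrow> q = mix_ratio p a b"
  shows "ennreal_of_prob (mix p a b) * mix_ennreal q x y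
    = mix_ennreal p (ennreal_of_prob a * x) (ennreal_of_prob b * y)"
  using mix_ratio_weights[OF assms]
  by (simp add: mix_ennreal_def distrib_left mult.assoc[symmetric])

lemma ennreal_of_prob_mix:
  "ennreal_of_prob (mix p a b) = mix_ennreal p (ennreal_of_prob a) (ennreal_of_prob b)"
  by (simp add: mix.rep_eq mix_ennreal_def)

lemma mult_mix_ratio:
  assumes "mix p a b \<noteq> 0 \<Longrightarrow> q = mix_ratio p a b"
  shows "mix p a b * mix q x y = mix p (a * x) (b * y)"
  using mult_mix_ennreal_ratio[OF assms, of "ennreal_of_prob x" "ennreal_of_prob y"]
  by (simp add: ennreal_of_prob_inject[symmetric] times_prob.rep_eq ennreal_of_prob_mix)


section \<open>Monotonicity and splitting of the conditional transformers\<close>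

lemma mixE_mono: "f \<le> f' \<Longrightarrow> k \<le> k' \<Longrightarrow> mixE p f k \<le> mixE p f' k'"
  by (simp add: mixE_def le_fun_def mix_ennreal_mono)

lemma mixE1_mono: "g \<le> g' \<Longrightarrow> k \<le> k' \<Longrightarrow> mixE1 p g k \<le> mixE1 p g' k'"
  by (simp add: mixE1_def le_fun_def mix_mono)

lemma mono_wp: "mono (wp P)"
proof (induction P)
  case (While G P)
  then show ?case
    by (auto intro!: monoI lfp_mono mixE_mono)
next
  case (Choice P p Q)
  show ?case
    by (auto intro!: monoI mixE_mono intro: Choice.IH[THEN monoD])
next
  case (Seq P Q)
  show ?case
    by (auto intro!: monoI intro: Seq.IH[THEN monoD])
next
  case (Ite G P Q)
  show ?case
    by (auto intro!: monoI mixE_mono intro: Ite.IH[THEN monoD])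
qed (auto intro!: monoI le_funI mult_left_mono simp: subst_def scaleE_def dest: le_funD)

lemma mono_wlp: "mono (wlp P)"
proof (induction P)
  case (While G P)
  then show ?case
    by (auto intro!: monoI gfp_mono mixE1_mono)
next
  case (Choice P p Q)
  show ?case
    by (auto intro!: monoI mixE1_mono intro: Choice.IH[THEN monoD])
next
  case (Seq P Q)
  show ?case
    by (auto intro!: monoI intro: Seq.IH[THEN monoD])
next
  case (Ite G P Q)
  show ?case
    by (auto intro!: monoI mixE1_mono intro: Ite.IH[THEN monoD])
qed (auto intro!: monoI le_funI mult_left_mono_prob simp: subst_def scaleE1_def dest: le_funD)

lemma mono_wp_loop: "mono (\<lambda>X. mixE (chi G) (wp P X) f)"
  by (intro monoI mixE_mono monoD[OF mono_wp] order_refl)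

lemma mono_wlp_loop: "mono (\<lambda>X. mixE1 (chi G) (wlp P X) g)"
  by (intro monoI mixE1_mono monoD[OF mono_wlp] order_refl)

text \<open>No rule lets the two components interact. By induction a loop functional is a product
  map, whose fixed point splits into an \<open>lfp\<close> and a \<open>gfp\<close>.\<close>

lemma cwp_eq: "cwp P = map_prod (wp P) (wlp P)"
proof (induction P)
  case (While G P)
  have "(\<lambda>Z. mixEE1 (chi G) (cwp P Z) (f, g))
      = map_prod (\<lambda>X. mixE (chi G) (wp P X) f) (\<lambda>X. mixE1 (chi G) (wlp P X) g)" for f g
    by (auto simp: While mixEE1_def)
  then show ?case
    by (auto simp: fun_eq_iff[of "cwp _"] lfp_dual_prod mono_wp_loop mono_wlp_loop)
qed (auto simp: fun_eq_iff[of "cwp _"] mixEE1_def)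

lemma cwlp_eq: "cwlp P = map_prod (wlp P) (wlp P)"
proof (induction P)
  case (While G P)
  have "(\<lambda>Z. mixE1E1 (chi G) (cwlp P Z) (f, g))
      = map_prod (\<lambda>X. mixE1 (chi G) (wlp P X) f) (\<lambda>X. mixE1 (chi G) (wlp P X) g)" for f g
    by (auto simp: While mixE1E1_def)
  then show ?case
    by (auto simp: fun_eq_iff[of "cwlp _"] gfp_prod mono_wlp_loop)
qed (auto simp: fun_eq_iff[of "cwlp _"] mixE1E1_def)


section \<open>Correctness of hoisting\<close>

text \<open>The postexpectation obeys the rules of \<open>wlp\<close> clause by clause; neither the
  hoisted program nor \<open>arb\<close> feeds back into it.\<close>

lemma snd_hoist: "snd (hoist arb P f) = wlp P f"
  by (induction P arbitrary: f) (simp_all add: Let_def split_beta)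

lemma fst_hoist_Seq:
  "fst (hoist arb (Seq P Q) f) = Seq (fst (hoist arb P (wlp Q f))) (fst (hoist arb Q f))"
  by (simp add: split_beta snd_hoist)

lemma fst_hoist_Ite:
  "fst (hoist arb (Ite G P Q) f) = Ite G (fst (hoist arb P f)) (fst (hoist arb Q f))"
  by (simp add: split_beta)

text \<open>Hides \<open>arb\<close>: the new probability \<open>q\<close> is known only where the
  denominator is nonzero, which is all that \<open>mix_ratio_weights\<close> asks for.\<close>

lemma fst_hoist_Choice:
  obtains q where "fst (hoist arb (Choice P p Q) f)
      = Choice (fst (hoist arb P f)) q (fst (hoist arb Q f))"
    and "\<And>\<sigma>. mix (p \<sigma>) (wlp P f \<sigma>) (wlp Q f \<sigma>) \<noteq> 0 \<Longrightarrow>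
      q \<sigma> = mix_ratio (p \<sigma>) (wlp P f \<sigma>) (wlp Q f \<sigma>)"
  by (rule that[of "\<lambda>\<sigma>. if mix (p \<sigma>) (wlp P f \<sigma>) (wlp Q f \<sigma>) = 0
        then arb (Choice P p Q) f \<sigma> else mix_ratio (p \<sigma>) (wlp P f \<sigma>) (wlp Q f \<sigma>)"])
    (simp_all add: split_beta snd_hoist Let_def)

lemma fst_hoist_While:
  "fst (hoist arb (While G P) f) = While G (fst (hoist arb P (wlp (While G P) f)))"
  by (simp add: snd_hoist Let_def)

lemma wlp_While_unfold:
  "wlp (While G P) g = mixE1 (chi G) (wlp P (wlp (While G P) g)) g"
  using gfp_unfold[OF mono_wlp_loop[of G P g]] by simp

section \<open>Scaling against suprema and infima\<close>

lemma scaleE_Sup: "scaleE h (Sup M) = Sup (scaleE h ` M)"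
  by (rule ext) (simp add: scaleE_def image_image SUP_mult_left_ennreal)

lemma le_scaleE1_Inf:
  assumes "M \<noteq> {}" and le: "\<And>X. X \<in> M \<Longrightarrow> Y \<le> scaleE1 h X"
  shows "Y \<le> scaleE1 h (Inf M)"
proof (rule le_funI)
  fix \<sigma>
  have "Y \<sigma> \<le> h \<sigma> * (INF X\<in>M. X \<sigma>)"
    using assms by (intro le_mult_Inf_prob) (auto simp: scaleE1_def le_fun_def)
  then show "Y \<sigma> \<le> scaleE1 h (Inf M) \<sigma>" by (simp add: scaleE1_def)
qed

text \<open>The product form avoids division where \<open>wlp P f0\<close> is 0. Generalising
  \<open>f0\<close> is essential, as sequences and loops hoist their parts from other
  postexpectations.\<close>

theorem wp_hoist:
  "scaleE (wlp P f0) (wp (fst (hoist arb P f0)) f) = wp P (scaleE f0 f)"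
proof (induction P arbitrary: f0 f)
  case (Seq P Q)
  \<comment> \<open>The hypothesis for \<open>P\<close>, taken at \<open>wlp Q f0\<close>, moves
    that factor inside \<open>wp P\<close>, where the hypothesis for \<open>Q\<close> absorbs
    it.\<close>
  show ?case by (simp add: fst_hoist_Seq Seq del: hoist.simps)
next
  case (Ite G P Q)
  have "scaleE (wlp (Ite G P Q) f0) (wp (fst (hoist arb (Ite G P Q) f0)) f)
      = mixE (chi G) (scaleE (wlp P f0) (wp (fst (hoist arb P f0)) f))
          (scaleE (wlp Q f0) (wp (fst (hoist arb Q f0)) f))"
    by (auto simp: fst_hoist_Ite scaleE_def mixE_def mixE1_def chi_def simp del: hoist.simps)
  then show ?case by (simp add: Ite)
next
  case (Choice P p Q)
  obtain q where q: "fst (hoist arb (Choice P p Q) f0)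
      = Choice (fst (hoist arb P f0)) q (fst (hoist arb Q f0))"
    and ratio: "\<And>\<sigma>. mix (p \<sigma>) (wlp P f0 \<sigma>) (wlp Q f0 \<sigma>) \<noteq> 0 \<Longrightarrow>
      q \<sigma> = mix_ratio (p \<sigma>) (wlp P f0 \<sigma>) (wlp Q f0 \<sigma>)"
    by (rule fst_hoist_Choice[of arb P p Q f0]) (rule that)
  have "scaleE (wlp (Choice P p Q) f0) (wp (fst (hoist arb (Choice P p Q) f0)) f)
      = mixE p (scaleE (wlp P f0) (wp (fst (hoist arb P f0)) f))
          (scaleE (wlp Q f0) (wp (fst (hoist arb Q f0)) f))"
    unfolding q by (simp add: scaleE_def mixE_def mixE1_def mult_mix_ennreal_ratio[OF ratio])
  then show ?case by (simp add: Choice)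
next
  case (While G P)
  define h where "h = wlp (While G P) f0"
  have h: "h = mixE1 (chi G) (wlp P h) f0"
    unfolding h_def by (rule wlp_While_unfold)
  have commute: "scaleE h (mixE (chi G) (wp (fst (hoist arb P h)) X) f)
      = mixE (chi G) (wp P (scaleE h X)) (scaleE f0 f)" for X
  proof -
    \<comment> \<open>Only the outer factor \<open>h\<close> is unfolded: it is
      \<open>wlp P h\<close> under the guard, ready for the induction hypothesis at
      \<open>h\<close>, and \<open>f0\<close> outside it.\<close>
    have "scaleE h (mixE (chi G) (wp (fst (hoist arb P h)) X) f)
      = mixE (chi G) (scaleE (wlp P h) (wp (fst (hoist arb P h)) X)) (scaleE f0 f)"
      by (subst (1) h) (auto simp: scaleE_def mixE_def mixE1_def chi_def)
    then show ?thesis by (simp add: While)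
  qed
  have "scaleE h (lfp (\<lambda>X. mixE (chi G) (wp (fst (hoist arb P h)) X) f))
      = lfp (\<lambda>X. mixE (chi G) (wp P X) (scaleE f0 f))"
    by (rule lfp_fusion[where \<alpha> = "scaleE h", OF mono_wp_loop mono_wp_loop scaleE_Sup commute])
  then show ?case by (simp only: fst_hoist_While wp.simps h_def)
qed (auto simp: scaleE_def scaleE1_def subst_def times_prob.rep_eq mult.assoc)

theorem wlp_hoist:
  "scaleE1 (wlp P f0) (wlp (fst (hoist arb P f0)) g) = wlp P (scaleE1 f0 g)"
proof (induction P arbitrary: f0 g)
  case (Seq P Q)
  show ?case by (simp add: fst_hoist_Seq Seq del: hoist.simps)
next
  case (Ite G P Q)
  have "scaleE1 (wlp (Ite G P Q) f0) (wlp (fst (hoist arb (Ite G P Q) f0)) g)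
      = mixE1 (chi G) (scaleE1 (wlp P f0) (wlp (fst (hoist arb P f0)) g))
          (scaleE1 (wlp Q f0) (wlp (fst (hoist arb Q f0)) g))"
    by (auto simp: fst_hoist_Ite scaleE1_def mixE1_def chi_def simp del: hoist.simps)
  then show ?case by (simp add: Ite)
next
  case (Choice P p Q)
  obtain q where q: "fst (hoist arb (Choice P p Q) f0)
      = Choice (fst (hoist arb P f0)) q (fst (hoist arb Q f0))"
    and ratio: "\<And>\<sigma>. mix (p \<sigma>) (wlp P f0 \<sigma>) (wlp Q f0 \<sigma>) \<noteq> 0 \<Longrightarrow>
      q \<sigma> = mix_ratio (p \<sigma>) (wlp P f0 \<sigma>) (wlp Q f0 \<sigma>)"
    by (rule fst_hoist_Choice[of arb P p Q f0]) (rule that)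
  have "scaleE1 (wlp (Choice P p Q) f0) (wlp (fst (hoist arb (Choice P p Q) f0)) g)
      = mixE1 p (scaleE1 (wlp P f0) (wlp (fst (hoist arb P f0)) g))
          (scaleE1 (wlp Q f0) (wlp (fst (hoist arb Q f0)) g))"
    unfolding q by (simp add: scaleE1_def mixE1_def mult_mix_ratio[OF ratio])
  then show ?case by (simp add: Choice)
next
  case (While G P)
  define h where "h = wlp (While G P) f0"
  have h: "h = mixE1 (chi G) (wlp P h) f0"
    unfolding h_def by (rule wlp_While_unfold)
  have commute: "scaleE1 h (mixE1 (chi G) (wlp (fst (hoist arb P h)) X) g)
      = mixE1 (chi G) (wlp P (scaleE1 h X)) (scaleE1 f0 g)" for X
  proof -
    have "scaleE1 h (mixE1 (chi G) (wlp (fst (hoist arb P h)) X) g)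
      = mixE1 (chi G) (scaleE1 (wlp P h) (wlp (fst (hoist arb P h)) X)) (scaleE1 f0 g)"
      by (subst (1) h) (auto simp: scaleE1_def mixE1_def chi_def)
    then show ?thesis by (simp add: While)
  qed
  \<comment> \<open>Since \<open>g\<close> is at most 1, monotonicity of \<open>wlp\<close> puts the
    target fixed point below \<open>h\<close>, the image of \<open>top\<close>.\<close>
  have "scaleE1 f0 g \<le> f0"
    by (simp add: le_fun_def scaleE1_def mult_le_left_prob)
  then have "wlp (While G P) (scaleE1 f0 g) \<le> h"
    unfolding h_def by (rule monoD[OF mono_wlp])
  moreover have "scaleE1 h top = h"
    by (rule ext) (simp add: scaleE1_def, transfer, simp)
  ultimately have top: "gfp (\<lambda>X. mixE1 (chi G) (wlp P X) (scaleE1 f0 g)) \<le> scaleE1 h top"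
    by simp
  have "scaleE1 h (gfp (\<lambda>X. mixE1 (chi G) (wlp (fst (hoist arb P h)) X) g))
      = gfp (\<lambda>X. mixE1 (chi G) (wlp P X) (scaleE1 f0 g))"
    by (rule gfp_fusion[where \<alpha> = "scaleE1 h",
          OF mono_wlp_loop mono_wlp_loop le_scaleE1_Inf top commute])
  then show ?case by (simp only: fst_hoist_While wlp.simps h_def)
qed (auto simp: scaleE1_def subst_def mult_assoc_prob)

theorem mainTheorem3:
  fixes P P' :: "('v, 'a) prog"
    and h :: "('v, 'a) state expectation1"
    and arb :: "('v, 'a) prog \<Rightarrow> ('v, 'a) state expectation1 \<Rightarrow> ('v, 'a) state \<Rightarrow> prob"
  assumes "feasible P"
    and "(P', h) = hoist arb P (\<lambda>_. 1)"
  shows "\<forall>(f :: ('v, 'a) state expectation) (g :: ('v, 'a) state expectation1).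
    wp P' f = cwp_quot P f \<and>
    (\<lambda>\<sigma>. ennreal_of_prob (wlp P' g \<sigma>)) = cwlp_quot P g"
proof (intro allI conjI ext)
  fix f :: "('v, 'a) state expectation" and g :: "('v, 'a) state expectation1"
    and \<sigma> :: "('v, 'a) state"
  have P': "P' = fst (hoist arb P (\<lambda>_. 1))"
    by (simp add: assms(2)[symmetric])
  \<comment> \<open>The common denominator of both quotients: \<open>cwp\<close> and
    \<open>cwlp\<close> share the second component \<open>wlp P\<close>. It is positive and finite,
    hence cancellable in \<open>ennreal\<close>.\<close>
  let ?d = "ennreal_of_prob (wlp P (\<lambda>_. 1) \<sigma>)"
  have "0 < ?d"
    using assms(1) by (auto simp: feasible_def cwp_eq less_prob.rep_eq zero_prob.rep_eq)
  moreover have "?d < top"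
    using prob_le_one[of "wlp P (\<lambda>_. 1) \<sigma>"] by (simp add: order_le_less_trans)
  ultimately have cancel: "x = y / ?d" if "?d * x = y" for x y
    using that by (auto simp: mult.commute[of ?d] mult_divide_eq_ennreal)
  have one: "scaleE (\<lambda>_. 1) f = f" "scaleE1 (\<lambda>_. 1) g = g"
    by (simp_all add: scaleE_def scaleE1_def one_prob.rep_eq)
  have "?d * wp P' f \<sigma> = wp P f \<sigma>"
    using fun_cong[OF wp_hoist[of P "\<lambda>_. 1" arb f], of \<sigma>] by (simp add: P' one, simp add: scaleE_def)
  then show "wp P' f \<sigma> = cwp_quot P f \<sigma>"
    by (simp add: cancel cwp_quot_def cwp_eq)
  have "?d * ennreal_of_prob (wlp P' g \<sigma>) = ennreal_of_prob (wlp P g \<sigma>)"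
    using fun_cong[OF wlp_hoist[of P "\<lambda>_. 1" arb g], of \<sigma>]
    by (simp add: P' one, simp add: scaleE1_def times_prob.rep_eq[symmetric])
  then show "ennreal_of_prob (wlp P' g \<sigma>) = cwlp_quot P g \<sigma>"
    by (simp add: cancel cwlp_quot_def cwlp_eq)
qed

end
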